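(* Let $m\ge 1$ and $p\ge 1$, and let $Y_1,\dots,Y_p$ be independent random $m\times m$ matrices with $Y_i\sim N_{m\times m}(0,d_i\Sigma_{\mathrm r},\Sigma_{\mathrm c})$, where $d_1,\dots,d_p>0$ and $\Sigma_{\mathrm r},\Sigma_{\mathrm c}\in\mathcal{S}_+^m$. Then, with probability one, the likelihood based on $Y_1,\dots,Y_p$, $$(d_1,\dots,d_p,\Sigma_{\mathrm r},\Sigma_{\mathrm c})\ \mapsto\ \prod_{i=1}^p(2\pi)^{-m^2/2}\left|\Sigma_{\mathrm c}\otimes d_i\Sigma_{\mathrm r}\right|^{-1/2}\exp\left(-\tfrac{1}{2d_i}\mathrm{tr}\left(\Sigma_{\mathrm r}^{-1}Y_i\Sigma_{\mathrm c}^{-1}Y_i^t\right)\right),$$ is bounded as a function of the covariance matrices $\Sigma_{\mathrm r},\Sigma_{\mathrm c}\in\mathcal{S}_+^m$ and the variance parameters $d_1,\dots,d_p\in(0,\infty)$.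
   Context: $\mathcal{S}_+^m$ is the set of $m\times m$ real symmetric positive definite matrices. $|\cdot|$ denotes the determinant, $\mathrm{tr}$ the trace, $\otimes$ the Kronecker product. $Y\sim N_{m\times m}(0,\Sigma_1,\Sigma_2)$ means $\mathrm{vec}(Y)\sim N_{m^2}(0,\Sigma_2\otimes\Sigma_1)$. *)

theory Defs
  imports "HOL-Probability.Probability"
begin

definition spd_matrices :: "(real ^ 'n ^ 'n) set" where
  "spd_matrices = {A. transpose A = A \<and> (\<forall>x. x \<noteq> 0 \<longrightarrow> x \<bullet> (A *v x) > 0)}"

(* The first component of an index pair selects the block, the second the
   position inside the block: block (i, j) of the product is A $ i $ j *\<^sub>R B. *)
definition kronecker :: "real ^ 'n ^ 'm \<Rightarrow> real ^ 'l ^ 'k \<Rightarrow> real ^ ('n \<times> 'l) ^ ('m \<times> 'k)"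
    (infixl "\<otimes>\<^sub>K" 70) where
  "A \<otimes>\<^sub>K B = (\<chi> r s. A $ fst r $ fst s * B $ snd r $ snd s)"

(* Stacking of columns: the column is the outer (block) index, as required for
   the convention that the covariance of vec Y is (column cov.) \<otimes>\<^sub>K (row cov.). *)
definition vec_of_matrix :: "real ^ 'n ^ 'm \<Rightarrow> real ^ ('n \<times> 'm)" where
  "vec_of_matrix Y = (\<chi> r. Y $ snd r $ fst r)"

definition mvn_density :: "real ^ 'n \<Rightarrow> real ^ 'n ^ 'n \<Rightarrow> real ^ 'n \<Rightarrow> real" where
  "mvn_density \<mu> \<Sigma> x =
     (2 * pi) powr (- real CARD('n) / 2) * det \<Sigma> powr (- 1 / 2) *
     exp (- (1 / 2) * ((x - \<mu>) \<bullet> (matrix_inv \<Sigma> *v (x - \<mu>))))"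

(* Non-degenerate normal law, given by its Lebesgue density; meaningful for
   \<Sigma> symmetric positive definite. *)
definition mvn_distributed ::
    "'a measure \<Rightarrow> ('a \<Rightarrow> real ^ 'n) \<Rightarrow> real ^ 'n \<Rightarrow> real ^ 'n ^ 'n \<Rightarrow> bool" where
  "mvn_distributed M X \<mu> \<Sigma> \<longleftrightarrow> distributed M lborel X (\<lambda>x. ennreal (mvn_density \<mu> \<Sigma> x))"

definition matrix_normal_distributed ::
    "'a measure \<Rightarrow> ('a \<Rightarrow> real ^ 'm ^ 'm) \<Rightarrow> real ^ 'm ^ 'm \<Rightarrow> real ^ 'm ^ 'm \<Rightarrow> real ^ 'm ^ 'm \<Rightarrow> bool" where
  "matrix_normal_distributed M Y \<mu> \<Sigma>\<^sub>1 \<Sigma>\<^sub>2 \<longleftrightarrow>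
     mvn_distributed M (\<lambda>\<omega>. vec_of_matrix (Y \<omega>)) (vec_of_matrix \<mu>) (\<Sigma>\<^sub>2 \<otimes>\<^sub>K \<Sigma>\<^sub>1)"

definition likelihood ::
    "nat \<Rightarrow> (nat \<Rightarrow> real ^ 'm ^ 'm) \<Rightarrow> (nat \<Rightarrow> real) \<Rightarrow> real ^ 'm ^ 'm \<Rightarrow> real ^ 'm ^ 'm \<Rightarrow> real" where
  "likelihood p Y d \<Sigma>r \<Sigma>c =
     (\<Prod>i=1..p. (2 * pi) powr (- (real CARD('m))\<^sup>2 / 2) *
        det (\<Sigma>c \<otimes>\<^sub>K (d i *\<^sub>R \<Sigma>r)) powr (- 1 / 2) *
        exp (- (1 / (2 * d i)) *
          trace (matrix_inv \<Sigma>r ** Y i ** matrix_inv \<Sigma>c ** transpose (Y i))))"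

end

theory Submission
  imports Defs
begin

text \<open>
  Factor \<open>\<Sigma>r\<inverse> = P P\<^sup>T\<close> and \<open>\<Sigma>c\<inverse> = Q Q\<^sup>T\<close>, and put \<open>Z = P\<^sup>T Y Q\<close>. The exponent of a factor of the
  likelihood is \<open>- t / 2\<close> with \<open>t = \<bar>Z\<bar>\<^sup>2 / d\<close> (Frobenius norm), while the determinant of its
  covariance equals \<open>(d ^ m (det Y)\<^sup>2 / (det Z)\<^sup>2) ^ m\<close>. Since \<open>\<bar>det Z\<bar> \<le> m! \<bar>Z\<bar> ^ m\<close>, each factor is at
  most a constant depending on \<open>det Y\<close> times \<open>t powr (m\<^sup>2 / 2) * exp (- t / 2)\<close>, hence bounded as
  soon as \<open>det Y \<noteq> 0\<close>. The latter holds almost surely: every line in the direction of the identity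
  matrix meets the singular matrices in finitely many points, so by Fubini they form a Lebesgue
  null set.
\<close>

section \<open>Determinants of Kronecker products\<close>

text \<open>Matrices are generated by elementary ones, so it is enough to compare both sides on
  matrices with a zero row, diagonal matrices, swaps and transvections. The intended \<phi> is the
  determinant of a larger matrix that depends multiplicatively on \<open>A\<close>, which avoids
  expanding that determinant.\<close>

lemma multiplicative_eq_det_power:
  fixes \<phi> :: "real ^ 'n ^ 'n \<Rightarrow> real"
  assumes mult: "\<And>A B. \<phi> (A ** B) = \<phi> A * \<phi> B"
    and diagonal: "\<And>A. (\<And>i j. i \<noteq> j \<Longrightarrow> A $ i $ j = 0) \<Longrightarrow> \<phi> A = (\<Prod>i\<in>UNIV. A $ i $ i) ^ k"
    and "k > 0"
  shows "\<phi> A = det A ^ k"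
proof -
  define D :: "('n \<Rightarrow> real) \<Rightarrow> real ^ 'n ^ 'n" where "D f = (\<chi> i j. if i = j then f i else 0)" for f
  have D: "\<psi> (D f) = (\<Prod>i\<in>UNIV. f i) ^ l"
    if "\<And>A. (\<And>i j. i \<noteq> j \<Longrightarrow> A $ i $ j = 0) \<Longrightarrow> \<psi> A = (\<Prod>i\<in>UNIV. A $ i $ i) ^ l"
    for \<psi> :: "real ^ 'n ^ 'n \<Rightarrow> real" and f l
    using that[of "D f"] by (simp add: D_def)
  define \<sigma> :: "'n \<Rightarrow> 'n \<Rightarrow> real ^ 'n ^ 'n"
    where "\<sigma> m n = (\<chi> i j. mat 1 $ i $ Transposition.transpose m n j)" for m n
  define E :: "'n \<Rightarrow> 'n \<Rightarrow> real \<Rightarrow> real ^ 'n ^ 'n"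
    where "E m n c = (\<chi> i j. if i = m \<and> j = n then c else of_bool (i = j))" for m n c
  \<comment> \<open>On the coordinates m and n this is the block with rows (1, 1) and (1, -1),
    elsewhere the identity. Its columns are eigenvectors of the swap, for the eigenvalue -1 in
    column n and 1 otherwise. Its square is diagonal with nonzero entries, so \<psi> cannot vanish
    on it and may be cancelled.\<close>
  define H :: "'n \<Rightarrow> 'n \<Rightarrow> real ^ 'n ^ 'n"
    where "H m n = (\<chi> i j. if i = j then (if i = n then -1 else 1)
       else of_bool (i = m \<and> j = n \<or> i = n \<and> j = m))" for m n
  have D_mult: "(D f ** A) $ i $ j = f i * A $ i $ j" and mult_D: "(A ** D f) $ i $ j = A $ i $ j * f j"
    for f A i j
    by (simp_all add: D_def matrix_matrix_mult_def if_distrib[of "\<lambda>x. x * y" for y]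
        if_distrib[of "\<lambda>x. y * x" for y] cong: if_cong)
  have H_mult: "(H m n ** A) $ i $ j =
      (if i = n then A $ m $ j - A $ n $ j else if i = m then A $ m $ j + A $ n $ j else A $ i $ j)"
    if "m \<noteq> n" for m n A i j
  proof -
    have "(H m n ** A) $ i $ j = (\<Sum>k\<in>UNIV. H m n $ i $ k * A $ k $ j)"
      by (simp add: matrix_matrix_mult_def)
    also have "\<dots> = (\<Sum>k\<in>UNIV. (if k = i then (if i = n then - A $ i $ j else A $ i $ j) else 0)
        + (if k = n then (if i = m then A $ k $ j else 0) else 0)
        + (if k = m then (if i = n then A $ k $ j else 0) else 0))"
      using that by (intro sum.cong) (auto simp: H_def)
    also have "\<dots> = (if i = n then A $ m $ j - A $ n $ j else if i = m then A $ m $ j + A $ n $ j else A $ i $ j)"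
      using that by (simp add: sum.distrib)
    finally show ?thesis .
  qed
  have E_mult: "(E m n c ** A) $ i $ j = (if i = m then A $ m $ j + c * A $ n $ j else A $ i $ j)"
    if "m \<noteq> n" for m n c A i j
  proof -
    have "(E m n c ** A) $ i $ j = (\<Sum>k\<in>UNIV. E m n c $ i $ k * A $ k $ j)"
      by (simp add: matrix_matrix_mult_def)
    also have "\<dots> = (\<Sum>k\<in>UNIV. (if k = i then A $ k $ j else 0)
        + (if k = n then (if i = m then c * A $ k $ j else 0) else 0))"
      using that by (intro sum.cong) (auto simp: E_def)
    also have "\<dots> = (if i = m then A $ m $ j + c * A $ n $ j else A $ i $ j)"
      using that by (simp add: sum.distrib)
    finally show ?thesis .
  qed
  have \<sigma>_mult: "(\<sigma> m n ** A) $ i $ j = A $ Transposition.transpose m n i $ j" for m n A i j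
  proof -
    have "i = Transposition.transpose m n k \<longleftrightarrow> k = Transposition.transpose m n i" for k
      by (metis transpose_involutory)
    then show ?thesis
      by (simp add: matrix_matrix_mult_def \<sigma>_def mat_def if_distrib[of "\<lambda>x. x * y" for y] cong: if_cong)
  qed
  have \<sigma>H: "\<sigma> m n ** H m n = H m n ** D (\<lambda>i. if i = n then -1 else 1)" if "m \<noteq> n" for m n
    using that
    by (auto simp: vec_eq_iff \<sigma>_mult mult_D H_def Transposition.transpose_def)
  have HH: "H m n ** H m n = D (\<lambda>i. if i = n \<or> i = m then 2 else 1)" if "m \<noteq> n" for m n
    using that by (auto simp: vec_eq_iff H_mult) (auto simp: H_def D_def)
  \<comment> \<open>Conjugation by the matrix that doubles coordinate m turns c into 2 * c, and the
    transvection with parameter 2 * c is the square of the one with parameter c.\<close>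
  have ED: "D (\<lambda>i. if i = m then 2 else 1) ** E m n c =
      E m n c ** (E m n c ** D (\<lambda>i. if i = m then 2 else 1))" if "m \<noteq> n" for m n c
    using that by (auto simp: vec_eq_iff E_mult D_mult mult_D) (auto simp: E_def)
  have EE: "E m n c ** E m n (-c) = D (\<lambda>i. 1)" if "m \<noteq> n" for m n c
    using that by (auto simp: vec_eq_iff E_mult) (auto simp: E_def D_def)
  txt \<open>The transposition matrix is similar to a diagonal one, and a transvection to its own square;
    so the diagonal values of a multiplicative function determine its values on both.\<close>
  have elementary: "\<psi> (\<sigma> m n) = (-1) ^ l \<and> \<psi> (E m n c) = 1"
    if \<psi>: "\<And>A B. \<psi> (A ** B) = \<psi> A * \<psi> B"
      "\<And>A. (\<And>i j. i \<noteq> j \<Longrightarrow> A $ i $ j = 0) \<Longrightarrow> \<psi> A = (\<Prod>i\<in>UNIV. A $ i $ i) ^ l"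
      and "m \<noteq> n"
    for \<psi> :: "real ^ 'n ^ 'n \<Rightarrow> real" and m n c l
  proof
    note D\<psi> = D[OF \<psi>(2)]
    have "\<psi> (H m n) * \<psi> (H m n) \<noteq> 0"
      using HH[OF \<open>m \<noteq> n\<close>] by (simp add: \<psi>(1)[symmetric] D\<psi>)
    moreover have "\<psi> (\<sigma> m n) * \<psi> (H m n) = \<psi> (H m n) * (-1) ^ l"
      using arg_cong[OF \<sigma>H[OF \<open>m \<noteq> n\<close>], of \<psi>] by (simp add: \<psi>(1) D\<psi>)
    ultimately show "\<psi> (\<sigma> m n) = (-1) ^ l"
      by auto
    have "\<psi> (E m n c) * \<psi> (E m n (-c)) = 1"
      using EE[OF \<open>m \<noteq> n\<close>] by (simp add: \<psi>(1)[symmetric] D\<psi>)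
    then have "\<psi> (E m n c) \<noteq> 0"
      by auto
    moreover have "\<psi> (D (\<lambda>i. if i = m then 2 else 1)) * \<psi> (E m n c) =
        \<psi> (E m n c) * (\<psi> (E m n c) * \<psi> (D (\<lambda>i. if i = m then 2 else 1)))"
      using arg_cong[OF ED[OF \<open>m \<noteq> n\<close>], of \<psi>] by (simp only: \<psi>(1))
    moreover have "\<psi> (D (\<lambda>i. if i = m then 2 else 1)) \<noteq> 0"
      by (simp add: D\<psi>)
    ultimately show "\<psi> (E m n c) = 1"
      by simp
  qed
  show ?thesis
  proof (induction A rule: induct_matrix_elementary)
    case (1 A B)
    then show ?case
      by (simp add: mult det_mul power_mult_distrib)
  next
    case (2 A i)
    \<comment> \<open>A zero row i means that the projection killing coordinate i fixes
      \<open>A\<close>. Since \<open>k > 0\<close>, \<phi> sends this projection to 0.\<close>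
    then have "D (\<lambda>j. if j = i then 0 else 1) ** A = A"
      by (auto simp: vec_eq_iff D_mult row_def)
    then have "\<phi> A = \<phi> (D (\<lambda>j. if j = i then 0 else 1)) * \<phi> A"
      by (metis mult)
    also have "\<phi> (D (\<lambda>j. if j = i then 0 else 1)) = 0"
      using \<open>k > 0\<close> by (simp add: D[OF diagonal])
    finally show ?case
      using 2 \<open>k > 0\<close> by (simp add: det_zero_row)
  next
    case (3 A)
    then show ?case
      by (simp add: diagonal det_diagonal)
  next
    case (4 m n)
    have "\<phi> (\<sigma> m n) = (-1) ^ k \<and> \<phi> (E m n 0) = 1"
      by (rule elementary) (use 4 in \<open>simp_all add: mult diagonal\<close>)
    \<comment> \<open>The determinant satisfies the same two conditions with exponent 1, so both
      sides of the claim are evaluated by \<open>elementary\<close>.\<close>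
    moreover have "det (\<sigma> m n) = (-1) ^ 1 \<and> det (E m n 0) = 1"
      by (rule elementary) (use 4 in \<open>simp_all add: det_mul det_diagonal\<close>)
    ultimately show ?case
      by (simp add: \<sigma>_def)
  next
    case (5 m n c)
    have "\<phi> (\<sigma> m n) = (-1) ^ k \<and> \<phi> (E m n c) = 1"
      by (rule elementary) (use 5 in \<open>simp_all add: mult diagonal\<close>)
    moreover have "det (\<sigma> m n) = (-1) ^ 1 \<and> det (E m n c) = 1"
      by (rule elementary) (use 5 in \<open>simp_all add: det_mul det_diagonal\<close>)
    ultimately show ?case
      by (simp add: E_def)
  qed
qed

lemma kronecker_mult:
  fixes A :: "real ^ 'n ^ 'm" and B :: "real ^ 'l ^ 'k" and C :: "real ^ 'r ^ 'n" and D :: "real ^ 's ^ 'l"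
  shows "(A \<otimes>\<^sub>K B) ** (C \<otimes>\<^sub>K D) = (A ** C) \<otimes>\<^sub>K (B ** D)"
proof -
  have "(\<Sum>k\<in>UNIV. A $ fst r $ fst k * B $ snd r $ snd k * (C $ fst k $ fst s * D $ snd k $ snd s)) =
      (\<Sum>i\<in>UNIV. A $ fst r $ i * C $ i $ fst s) * (\<Sum>j\<in>UNIV. B $ snd r $ j * D $ j $ snd s)" for r s
    unfolding sum_product sum.cartesian_product
    by (simp add: case_prod_unfold mult_ac)
  then show ?thesis
    by (simp add: kronecker_def matrix_matrix_mult_def vec_eq_iff)
qed

text \<open>Split the product as (A \<otimes> 1)(1 \<otimes> B). The determinant of each factor is
  multiplicative in \<open>A\<close> or \<open>B\<close>, and a diagonal argument makes the factor
  diagonal, so each is a power of \<open>det A\<close> or \<open>det B\<close>.\<close>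

lemma det_kronecker:
  fixes A :: "real ^ 'n ^ 'n" and B :: "real ^ 'm ^ 'm"
  shows "det (A \<otimes>\<^sub>K B) = det A ^ CARD('m) * det B ^ CARD('n)"
proof -
  have prod: "(\<Prod>r\<in>UNIV. f (fst r) * g (snd r)) = (\<Prod>i\<in>UNIV. f i) ^ CARD('m) * (\<Prod>j\<in>UNIV. g j) ^ CARD('n)"
    for f :: "'n \<Rightarrow> real" and g :: "'m \<Rightarrow> real"
  proof -
    have "(\<Prod>r\<in>UNIV. f (fst r) * g (snd r)) = (\<Prod>i\<in>UNIV. \<Prod>j\<in>UNIV. f i * g j)"
      by (simp add: prod.cartesian_product case_prod_unfold)
    then show ?thesis
      by (simp add: prod.distrib prod_power_distrib)
  qed
  have "det (A \<otimes>\<^sub>K mat 1 :: real ^ ('n \<times> 'm) ^ ('n \<times> 'm)) = det A ^ CARD('m)"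
  proof (rule multiplicative_eq_det_power)
    fix C :: "real ^ 'n ^ 'n"
    assume "\<And>i j. i \<noteq> j \<Longrightarrow> C $ i $ j = 0"
    then show "det (C \<otimes>\<^sub>K mat 1 :: real ^ ('n \<times> 'm) ^ ('n \<times> 'm)) = (\<Prod>i\<in>UNIV. C $ i $ i) ^ CARD('m)"
      using prod[of "\<lambda>i. C $ i $ i" "\<lambda>_. 1"]
      by (subst det_diagonal) (auto simp: kronecker_def mat_def prod_eq_iff)
  qed (simp_all add: det_mul[symmetric] kronecker_mult)
  moreover have "det (mat 1 \<otimes>\<^sub>K B :: real ^ ('n \<times> 'm) ^ ('n \<times> 'm)) = det B ^ CARD('n)"
  proof (rule multiplicative_eq_det_power)
    fix C :: "real ^ 'm ^ 'm"
    assume "\<And>i j. i \<noteq> j \<Longrightarrow> C $ i $ j = 0"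
    then show "det (mat 1 \<otimes>\<^sub>K C :: real ^ ('n \<times> 'm) ^ ('n \<times> 'm)) = (\<Prod>i\<in>UNIV. C $ i $ i) ^ CARD('n)"
      using prod[of "\<lambda>_. 1" "\<lambda>i. C $ i $ i"]
      by (subst det_diagonal) (auto simp: kronecker_def mat_def prod_eq_iff)
  qed (simp_all add: det_mul[symmetric] kronecker_mult)
  moreover have "A \<otimes>\<^sub>K B = (A \<otimes>\<^sub>K mat 1) ** (mat 1 \<otimes>\<^sub>K B)"
    by (simp add: kronecker_mult)
  ultimately show ?thesis
    by (simp add: det_mul)
qed

section \<open>Factorization of positive definite matrices\<close>

text \<open>Gram-Schmidt with respect to the inner product given by the matrix.\<close>
lemma spd_congruent_identity:
  fixes A :: "real ^ 'n ^ 'n"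
  assumes "A \<in> spd_matrices"
  obtains P :: "real ^ 'n ^ 'n" where "transpose P ** A ** P = mat 1"
proof -
  have sym: "transpose A = A" and pos: "\<And>x. x \<noteq> 0 \<Longrightarrow> x \<bullet> (A *v x) > 0"
    using assms by (auto simp: spd_matrices_def)
  have comm: "x \<bullet> (A *v y) = y \<bullet> (A *v x)" for x y
    by (metis dot_lmul_matrix inner_commute sym transpose_matrix_vector)
  have "\<exists>b. \<forall>i\<in>S. \<forall>j\<in>S. b i \<bullet> (A *v b j) = of_bool (i = j)" for S :: "'n set"
  proof (induction S rule: finite_induct[OF finite])
    case 1
    then show ?case by simp
  next
    case (2 s S)
    then obtain b where b: "\<And>i j. i \<in> S \<Longrightarrow> j \<in> S \<Longrightarrow> b i \<bullet> (A *v b j) = of_bool (i = j)"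
      by blast
    \<comment> \<open>No vector has to be orthogonalized explicitly: fewer than n vectors
      \<open>A *v b i\<close> leave a nonzero x orthogonal to all of them, and this is orthogonality
      to each \<open>b i\<close> in the inner product given by \<open>A\<close>.\<close>
    have "dim ((\<lambda>i. A *v b i) ` S) \<le> card S"
      by (meson "2.hyps"(1) card_image_le dim_le_card' finite_imageI le_trans)
    also have "card S < CARD('n)"
      by (metis "2.hyps"(2) UNIV_I finite_class.finite_UNIV psubsetI psubset_card_mono subset_UNIV)
    finally obtain x where x: "x \<noteq> 0" "\<And>y. y \<in> span ((\<lambda>i. A *v b i) ` S) \<Longrightarrow> orthogonal x y"
      using orthogonal_to_subspace_exists by (metis DIM_cart DIM_real mult.right_neutral)
    define c where "c = x \<bullet> (A *v x)"
    have c: "c > 0" using pos[OF x(1)] by (simp add: c_def)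
    define u where "u = (1 / sqrt c) *\<^sub>R x"
    have uu: "u \<bullet> (A *v u) = 1"
      using c by (simp add: u_def matrix_vector_mult_scaleR c_def[symmetric] field_simps)
    have ub: "u \<bullet> (A *v b i) = 0" if "i \<in> S" for i
      using x(2)[of "A *v b i"] that by (simp add: u_def orthogonal_def span_base)
    have bu: "b i \<bullet> (A *v u) = 0" if "i \<in> S" for i
      using ub[OF that] comm[of u "b i"] by simp
    have "(b(s := u)) i \<bullet> (A *v (b(s := u)) j) = of_bool (i = j)"
      if "i \<in> insert s S" "j \<in> insert s S" for i j
      using that b uu ub bu "2.hyps"(2) by (cases "i = s"; cases "j = s") auto
    then show ?case by blast
  qed
  from this[of UNIV] obtain b :: "'n \<Rightarrow> real ^ 'n" where b: "\<And>i j. b i \<bullet> (A *v b j) = of_bool (i = j)"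
    by auto
  define P :: "real ^ 'n ^ 'n" where "P = (\<chi> i j. b j $ i)"
  have "(transpose P ** A ** P) $ i $ j = mat 1 $ i $ j" for i j
  proof -
    have "(transpose P ** (A ** P)) $ i $ j = b i \<bullet> (A *v b j)"
      by (simp add: P_def matrix_matrix_mult_def transpose_def inner_vec_def matrix_vector_mult_def)
    then show ?thesis
      by (simp add: b mat_def matrix_mul_assoc)
  qed
  then show thesis
    by (intro that[of P]) (simp add: vec_eq_iff)
qed

lemma spd_inverse_factorization:
  fixes A :: "real ^ 'n ^ 'n"
  assumes "A \<in> spd_matrices"
  obtains P :: "real ^ 'n ^ 'n" where "matrix_inv A = P ** transpose P" "det P \<noteq> 0" "det A = 1 / (det P)\<^sup>2"
proof -
  obtain P :: "real ^ 'n ^ 'n" where P: "transpose P ** A ** P = mat 1"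
    using spd_congruent_identity[OF assms] .
  have "det (transpose P ** A ** P) = 1"
    by (simp add: P)
  then have det: "(det P)\<^sup>2 * det A = 1"
    by (simp add: det_mul power2_eq_square mult_ac)
  have nz: "det P \<noteq> 0"
    using det by auto
  \<comment> \<open>One-sided inverses of square matrices are two-sided, so \<open>P\<close> may
    move from the right end of the identity to the left, which exhibits
    \<open>P ** transpose P\<close> as the inverse of \<open>A\<close>.\<close>
  have "P ** (transpose P ** A) = mat 1"
    using P matrix_left_right_inverse by blast
  then have "(P ** transpose P) ** A = mat 1"
    by (simp add: matrix_mul_assoc)
  moreover from this have "A ** (P ** transpose P) = mat 1"
    using matrix_left_right_inverse by blast
  ultimately have inv: "A ** (P ** transpose P) = mat 1 \<and> (P ** transpose P) ** A = mat 1"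
    by blast
  then have "A ** matrix_inv A = mat 1"
    unfolding matrix_inv_def by (rule someI2) blast
  then have "matrix_inv A = P ** transpose P"
    by (metis inv matrix_mul_assoc matrix_mul_lid matrix_mul_rid)
  with nz det show thesis
    by (intro that[of P]) (auto simp: field_simps)
qed

section \<open>Trace and determinant against the Frobenius norm\<close>

lemma trace_mult_transpose:
  fixes Z :: "real ^ 'n ^ 'm"
  shows "trace (Z ** transpose Z) = (norm Z)\<^sup>2"
  by (simp add: trace_def matrix_matrix_mult_def transpose_def power2_norm_eq_inner inner_vec_def)

text \<open>Each of the n! terms of the Leibniz formula is a product of n entries, none larger than
  the norm. The crude constant is harmless; what matters later is the homogeneity of degree
  n.\<close>

lemma abs_det_le_norm_power:
  fixes Z :: "real ^ 'n ^ 'n"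
  shows "\<bar>det Z\<bar> \<le> fact CARD('n) * norm Z ^ CARD('n)"
proof -
  have entry: "\<bar>Z $ i $ j\<bar> \<le> norm Z" for i j
    using component_le_norm_cart[of "Z $ i" j] Finite_Cartesian_Product.norm_nth_le[of Z i] by simp
  have "\<bar>det Z\<bar> \<le> (\<Sum>\<pi>\<in>{\<pi>. \<pi> permutes (UNIV :: 'n set)}. \<bar>of_int (sign \<pi>) * (\<Prod>i\<in>UNIV. Z $ i $ \<pi> i)\<bar>)"
    unfolding det_def by (rule sum_abs)
  also have "\<dots> \<le> (\<Sum>\<pi>\<in>{\<pi>. \<pi> permutes (UNIV :: 'n set)}. norm Z ^ CARD('n))"
  proof (rule sum_mono)
    fix \<pi> :: "'n \<Rightarrow> 'n"
    have "(\<Prod>i\<in>UNIV. \<bar>Z $ i $ \<pi> i\<bar>) \<le> (\<Prod>i\<in>(UNIV :: 'n set). norm Z)"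
      by (intro prod_mono) (simp add: entry)
    then show "\<bar>of_int (sign \<pi>) * (\<Prod>i\<in>UNIV. Z $ i $ \<pi> i)\<bar> \<le> norm Z ^ CARD('n)"
      by (simp add: abs_mult abs_prod sign_def)
  qed
  also have "\<dots> = fact CARD('n) * norm Z ^ CARD('n)"
    by (simp add: card_permutations[OF refl])
  finally show ?thesis .
qed

section \<open>Almost sure nonsingularity\<close>

text \<open>Integrate the indicator of \<open>x + t *\<^sub>R v \<in> N\<close> over all x and over
  t in the unit interval. Integrating over t first gives 0, because countable sets are null;
  integrating over x first gives the measure of \<open>N\<close>, by translation invariance.\<close>

lemma null_set_of_countable_line_sections:
  fixes N :: "'a::euclidean_space set"
  assumes [measurable]: "N \<in> sets borel"
    and countable: "\<And>x. countable {t. x + t *\<^sub>R v \<in> N}"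
  shows "N \<in> null_sets lborel"
proof -
  define h :: "'a \<Rightarrow> real \<Rightarrow> ennreal"
    where "h x t = indicator N (x + t *\<^sub>R v) * indicator {0..1} t" for x t
  have [measurable]: "case_prod h \<in> borel_measurable (lborel \<Otimes>\<^sub>M lborel)"
    unfolding h_def by measurable
  have "(\<integral>\<^sup>+t. h x t \<partial>lborel) = 0" for x
  proof -
    have "{t. x + t *\<^sub>R v \<in> N} \<in> null_sets lborel"
      using countable by (rule countable_imp_null_set_lborel)
    then have "AE t in lborel. t \<notin> {t. x + t *\<^sub>R v \<in> N}"
      by (rule AE_not_in)
    then have "AE t in lborel. h x t = 0"
      by eventually_elim (simp add: h_def)
    then show ?thesis
      by (subst nn_integral_0_iff_AE) (auto simp: h_def)
  qed
  moreover have "(\<integral>\<^sup>+x. h x t \<partial>lborel) = emeasure lborel N * indicator {0..1} t" for t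
  proof -
    have "emeasure lborel N = emeasure (distr lborel borel ((+) (t *\<^sub>R v))) N"
      by (simp add: lborel_distr_plus)
    also have "\<dots> = (\<integral>\<^sup>+x. indicator N (x + t *\<^sub>R v) \<partial>lborel)"
      by (subst nn_integral_indicator[symmetric], simp, subst nn_integral_distr) (auto simp: add.commute)
    finally show ?thesis
      by (simp add: h_def nn_integral_multc)
  qed
  moreover have "(\<integral>\<^sup>+t. (\<integral>\<^sup>+x. h x t \<partial>lborel) \<partial>lborel) = (\<integral>\<^sup>+x. (\<integral>\<^sup>+t. h x t \<partial>lborel) \<partial>lborel)"
    by (rule lborel_pair.Fubini') measurable
  ultimately have "emeasure lborel N = 0"
    by (simp add: nn_integral_cmult)
  then show ?thesis
    by (simp add: null_sets_def)
qed

lemma det_poly: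
  fixes A :: "'a::comm_ring_1 poly ^ 'n ^ 'n"
  shows "poly (det A) t = det (\<chi> i j. poly (A $ i $ j) t)"
  by (simp add: det_def poly_sum poly_prod sign_def)

lemma det_scaleR:
  fixes A :: "real ^ 'n ^ 'n"
  shows "det (c *\<^sub>R A) = c ^ CARD('n) * det A"
  by (simp add: det_def prod.distrib sum_distrib_left mult_ac)

text \<open>Reversing the polynomial makes it visibly nonzero: det (s A + 1) equals 1 at s = 0. A
  root t \<noteq> 0 of det (A + t 1) corresponds to the root s = 1 / t, and t = 0 adds at most one
  point.\<close>

lemma finite_det_roots:
  fixes A :: "real ^ 'n ^ 'n"
  shows "finite {t. det (A + t *\<^sub>R mat 1) = 0}"
proof -
  define q :: "real poly" where "q = det (\<chi> i j. [:of_bool (i = j), A $ i $ j:])"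
  have q: "poly q s = det (s *\<^sub>R A + mat 1)" for s
    unfolding q_def det_poly by (intro arg_cong[where f = det]) (simp add: vec_eq_iff mat_def)
  have "poly q 0 = 1"
    by (simp add: q)
  then have "q \<noteq> 0"
    by auto
  have "poly q (inverse t) = 0" if "det (A + t *\<^sub>R mat 1) = 0" "t \<noteq> 0" for t
  proof -
    have "inverse t *\<^sub>R A + mat 1 = inverse t *\<^sub>R (A + t *\<^sub>R mat 1)"
      using that by (simp add: scaleR_add_right)
    then show ?thesis
      using that by (simp add: q det_scaleR)
  qed
  then have "{t. det (A + t *\<^sub>R mat 1) = 0} \<subseteq> insert 0 (inverse ` {s. poly q s = 0})"
    by (auto simp: image_iff) (metis inverse_inverse_eq)
  then show ?thesis
    using poly_roots_finite[OF \<open>q \<noteq> 0\<close>] finite_subset by blast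
qed

text \<open>The set is placed in the space of stacked vectors, where the normal density lives. There
  the direction of the lines is the stacked identity matrix, and continuity of the determinant gives
  measurability.\<close>

lemma null_set_singular_vec_of_matrix:
  "{v. \<exists>Y :: real ^ 'm ^ 'm. v = vec_of_matrix Y \<and> det Y = 0} \<in> null_sets lborel"
proof -
  \<comment> \<open>The indices are swapped because \<open>vec_of_matrix\<close> takes the column as
    the first component.\<close>
  define unvec :: "real ^ ('m \<times> 'm) \<Rightarrow> real ^ 'm ^ 'm" where "unvec v = (\<chi> i j. v $ (j, i))" for v
  have unvec: "unvec (vec_of_matrix Y) = Y" "vec_of_matrix (unvec v) = v" for Y v
    by (simp_all add: unvec_def vec_of_matrix_def vec_eq_iff)
  have eq: "{v. \<exists>Y :: real ^ 'm ^ 'm. v = vec_of_matrix Y \<and> det Y = 0} = {v. det (unvec v) = 0}"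
    by (auto simp: unvec) (metis unvec(2))
  have "continuous_on UNIV (\<lambda>v. det (unvec v))"
    unfolding unvec_def det_def by (intro continuous_intros)
  then have "(\<lambda>v. det (unvec v)) \<in> borel_measurable borel"
    by (rule borel_measurable_continuous_onI)
  then have meas: "{v. det (unvec v) = 0} \<in> sets borel"
    by measurable
  have "{v. det (unvec v) = 0} \<in> null_sets lborel"
  proof (rule null_set_of_countable_line_sections[OF meas, where v = "vec_of_matrix (mat 1)"])
    fix x :: "real ^ ('m \<times> 'm)"
    have "unvec (x + t *\<^sub>R vec_of_matrix (mat 1)) = unvec x + t *\<^sub>R mat 1" for t
      by (simp add: unvec_def vec_of_matrix_def vec_eq_iff)
    then show "countable {t. x + t *\<^sub>R vec_of_matrix (mat 1) \<in> {v. det (unvec v) = 0}}"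
      using finite_det_roots[of "unvec x"] by (simp add: countable_finite)
  qed
  then show ?thesis
    by (simp add: eq)
qed

text \<open>The law of the stacked matrix has a Lebesgue density, so it gives the null set of
  singular matrices probability 0.\<close>

lemma matrix_normal_AE_nonsingular:
  fixes Y :: "'a \<Rightarrow> real ^ 'm ^ 'm"
  assumes "matrix_normal_distributed M Y \<mu> \<Sigma>\<^sub>1 \<Sigma>\<^sub>2"
  shows "AE \<omega> in M. det (Y \<omega>) \<noteq> 0"
proof -
  let ?N = "{v. \<exists>Y :: real ^ 'm ^ 'm. v = vec_of_matrix Y \<and> det Y = 0}"
  let ?f = "\<lambda>x. ennreal (mvn_density (vec_of_matrix \<mu>) (\<Sigma>\<^sub>2 \<otimes>\<^sub>K \<Sigma>\<^sub>1) x)"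
  have dist: "distributed M lborel (\<lambda>\<omega>. vec_of_matrix (Y \<omega>)) ?f"
    using assms by (simp add: matrix_normal_distributed_def mvn_distributed_def)
  have "AE v in lborel. v \<notin> ?N"
    using null_set_singular_vec_of_matrix by (rule AE_not_in)
  then have "AE v in density lborel ?f. v \<notin> ?N"
    using distributed_borel_measurable[OF dist] by (subst AE_density) auto
  then have "AE v in distr M lborel (\<lambda>\<omega>. vec_of_matrix (Y \<omega>)). v \<notin> ?N"
    by (simp only: distributed_distr_eq_density[OF dist])
  then have "AE \<omega> in M. vec_of_matrix (Y \<omega>) \<notin> ?N"
    by (rule AE_distrD[OF distributed_measurable[OF dist]])
  then show ?thesis
    by eventually_elim blast
qed

section \<open>Bounding the likelihood\<close>

text \<open>A single term of the exponential series is at most its sum. This gives the explicit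
  bound n! for t ^ n * exp (- t).\<close>

lemma power_le_fact_mult_exp:
  fixes t :: real
  assumes "t \<ge> 0"
  shows "t ^ n \<le> fact n * exp t"
proof -
  have "(\<Sum>k\<in>{n}. t ^ k /\<^sub>R fact k) \<le> exp t"
    unfolding exp_def using assms by (intro sum_le_suminf summable_exp_generic) auto
  then show ?thesis
    by (simp add: field_simps)
qed

text \<open>The right-hand side involves only \<open>Y\<close> and the dimension, so the estimate is
  uniform in \<open>d\<close> and both covariance matrices.\<close>

lemma likelihood_factor_le:
  fixes Y \<Sigma>r \<Sigma>c :: "real ^ 'm ^ 'm"
  assumes "\<Sigma>r \<in> spd_matrices" "\<Sigma>c \<in> spd_matrices" "d > 0" "det Y \<noteq> 0"
  shows "det (\<Sigma>c \<otimes>\<^sub>K (d *\<^sub>R \<Sigma>r)) powr (- 1 / 2) *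
      exp (- (1 / (2 * d)) * trace (matrix_inv \<Sigma>r ** Y ** matrix_inv \<Sigma>c ** transpose Y))
    \<le> sqrt (fact (CARD('m) * CARD('m)) * ((fact CARD('m))\<^sup>2 / (det Y)\<^sup>2) ^ CARD('m))"
proof -
  let ?m = "CARD('m)"
  obtain P where P: "matrix_inv \<Sigma>r = P ** transpose P" "det P \<noteq> 0" "det \<Sigma>r = 1 / (det P)\<^sup>2"
    using spd_inverse_factorization[OF assms(1)] .
  obtain Q where Q: "matrix_inv \<Sigma>c = Q ** transpose Q" "det Q \<noteq> 0" "det \<Sigma>c = 1 / (det Q)\<^sup>2"
    using spd_inverse_factorization[OF assms(2)] .
  define Z where "Z = transpose P ** Y ** Q"
  define t where "t = (norm Z)\<^sup>2 / d"
  define K where "K = det (\<Sigma>c \<otimes>\<^sub>K (d *\<^sub>R \<Sigma>r))"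
  have "trace (matrix_inv \<Sigma>r ** Y ** matrix_inv \<Sigma>c ** transpose Y) =
      trace (P ** (transpose P ** Y ** Q ** transpose Q ** transpose Y))"
    by (simp add: P Q matrix_mul_assoc)
  also have "\<dots> = trace (Z ** transpose Z)"
    by (subst trace_mul_sym) (simp add: Z_def matrix_transpose_mul matrix_mul_assoc)
  finally have trace: "trace (matrix_inv \<Sigma>r ** Y ** matrix_inv \<Sigma>c ** transpose Y) = (norm Z)\<^sup>2"
    by (simp add: trace_mult_transpose)
  have Z: "det Z = det P * det Y * det Q"
    by (simp add: Z_def det_mul)
  have K: "K = (d ^ ?m * (det Y)\<^sup>2 / (det Z)\<^sup>2) ^ ?m"
    using assms(4) P(2) Q(2)
    by (simp add: K_def det_kronecker det_scaleR P(3) Q(3) Z power_mult_distrib[symmetric] power_divide[symmetric])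
       (simp add: field_simps power_mult_distrib)
  have "K > 0"
    using assms(3,4) P(2) Q(2) by (simp add: K Z)
  have "(det Z)\<^sup>2 \<le> (fact ?m * norm Z ^ ?m)\<^sup>2"
    using abs_det_le_norm_power[of Z] by (metis abs_ge_zero power2_abs power_mono)
  then have "(det Z)\<^sup>2 / (d ^ ?m * (det Y)\<^sup>2) \<le> (fact ?m * norm Z ^ ?m)\<^sup>2 / (d ^ ?m * (det Y)\<^sup>2)"
    using assms(3) by (intro divide_right_mono) auto
  \<comment> \<open>The powers of the norm and of \<open>d\<close> match, so they combine into t,
    the same quantity that appears in the exponent.\<close>
  also have "\<dots> = (fact ?m)\<^sup>2 / (det Y)\<^sup>2 * t ^ ?m"
    by (simp add: t_def power_mult_distrib power_divide power_mult[symmetric] mult.commute)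
  finally have "((det Z)\<^sup>2 / (d ^ ?m * (det Y)\<^sup>2)) ^ ?m \<le> ((fact ?m)\<^sup>2 / (det Y)\<^sup>2 * t ^ ?m) ^ ?m"
    using assms(3) by (intro power_mono) auto
  then have inv_K: "1 / K \<le> ((fact ?m)\<^sup>2 / (det Y)\<^sup>2) ^ ?m * t ^ (?m * ?m)"
    by (simp add: K power_mult_distrib power_divide power_mult)
  have t: "t \<ge> 0"
    using assms(3) by (simp add: t_def)
  \<comment> \<open>Putting the whole factor under one square root leaves an estimate with the
    integer power \<open>t ^ (?m * ?m)\<close> against \<open>exp (- t)\<close>.\<close>
  have "K powr (- 1 / 2) * exp (- (1 / (2 * d)) * (norm Z)\<^sup>2) = sqrt (exp (- t) / K)"
  proof -
    have "K powr (- 1 / 2) = 1 / sqrt K"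
      using \<open>K > 0\<close> by (simp add: powr_minus powr_half_sqrt divide_simps)
    moreover have "sqrt (exp (- t)) = exp (- t / 2)"
      by (rule real_sqrt_unique) (simp_all add: power2_eq_square exp_add[symmetric])
    ultimately show ?thesis
      by (simp add: real_sqrt_divide t_def)
  qed
  also have "\<dots> \<le> sqrt (fact (?m * ?m) * ((fact ?m)\<^sup>2 / (det Y)\<^sup>2) ^ ?m)"
  proof (rule real_sqrt_le_mono)
    have "exp (- t) * (1 / K) \<le> exp (- t) * (((fact ?m)\<^sup>2 / (det Y)\<^sup>2) ^ ?m * t ^ (?m * ?m))"
      by (intro mult_left_mono inv_K) simp
    also have "\<dots> \<le> exp (- t) * (((fact ?m)\<^sup>2 / (det Y)\<^sup>2) ^ ?m * (fact (?m * ?m) * exp t))"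
      by (intro mult_left_mono power_le_fact_mult_exp t) auto
    also have "\<dots> = fact (?m * ?m) * ((fact ?m)\<^sup>2 / (det Y)\<^sup>2) ^ ?m"
      by (simp add: exp_minus)
    finally show "exp (- t) / K \<le> fact (?m * ?m) * ((fact ?m)\<^sup>2 / (det Y)\<^sup>2) ^ ?m"
      by simp
  qed
  finally show ?thesis
    by (simp only: trace K_def)
qed

lemma bounded_likelihood:
  fixes Y :: "nat \<Rightarrow> real ^ 'm ^ 'm"
  assumes "\<And>i. i \<in> {1..p} \<Longrightarrow> det (Y i) \<noteq> 0"
  shows "bounded {likelihood p Y d \<Sigma>r \<Sigma>c | d \<Sigma>r \<Sigma>c.
    (\<forall>i\<in>{1..p}. d i > 0) \<and> \<Sigma>r \<in> spd_matrices \<and> \<Sigma>c \<in> spd_matrices}"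
proof -
  define C where "C = (\<Prod>i=1..p. (2 * pi) powr (- (real CARD('m))\<^sup>2 / 2) *
    sqrt (fact (CARD('m) * CARD('m)) * ((fact CARD('m))\<^sup>2 / (det (Y i))\<^sup>2) ^ CARD('m)))"
  have "\<bar>likelihood p Y d \<Sigma>r \<Sigma>c\<bar> \<le> C"
    if "\<forall>i\<in>{1..p}. d i > 0" "\<Sigma>r \<in> spd_matrices" "\<Sigma>c \<in> spd_matrices" for d \<Sigma>r \<Sigma>c
  proof -
    have "likelihood p Y d \<Sigma>r \<Sigma>c \<ge> 0"
      unfolding likelihood_def by (intro prod_nonneg) auto
    moreover have "likelihood p Y d \<Sigma>r \<Sigma>c \<le> C"
      unfolding likelihood_def C_def mult.assoc
      by (intro prod_mono conjI mult_left_mono likelihood_factor_le) (use that assms in auto)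
    ultimately show ?thesis
      by simp
  qed
  then show ?thesis
    unfolding bounded_iff by (intro exI[of _ C]) auto
qed

theorem theorem3:
  fixes M :: "'a measure"
    and Y :: "nat \<Rightarrow> 'a \<Rightarrow> real ^ 'm ^ 'm"
    and p :: nat
    and d0 :: "nat \<Rightarrow> real"
    and \<Sigma>r0 \<Sigma>c0 :: "real ^ 'm ^ 'm"
  assumes "prob_space M"
    and "p \<ge> 1"
    and "\<And>i. i \<in> {1..p} \<Longrightarrow> d0 i > 0"
    and "\<Sigma>r0 \<in> spd_matrices"
    and "\<Sigma>c0 \<in> spd_matrices"
    and "prob_space.indep_vars M (\<lambda>_. borel) Y {1..p}"
    and "\<And>i. i \<in> {1..p} \<Longrightarrow> matrix_normal_distributed M (Y i) 0 (d0 i *\<^sub>R \<Sigma>r0) \<Sigma>c0"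
  shows "AE \<omega> in M. bounded {likelihood p (\<lambda>i. Y i \<omega>) d \<Sigma>r \<Sigma>c | d \<Sigma>r \<Sigma>c.
           (\<forall>i\<in>{1..p}. d i > 0) \<and> \<Sigma>r \<in> spd_matrices \<and> \<Sigma>c \<in> spd_matrices}"
proof -
  \<comment> \<open>Each of the p events of a singular matrix is null, hence so is their finite
    union; outside it the deterministic bound applies.\<close>
  have "AE \<omega> in M. \<forall>i\<in>{1..p}. det (Y i \<omega>) \<noteq> 0"
    by (intro AE_finite_allI finite_atLeastAtMost matrix_normal_AE_nonsingular[OF assms(7)])
  then show ?thesis
    by eventually_elim (rule bounded_likelihood, blast)
qed

end
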